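(* Let $G$ be a metric graph with $n=|V(G)|$ vertices and vertex weights in $(0,1]$, some vertex having weight $1$. There exists a walk $W$ in $G$ of size $O(n^2)$ such that the infinite walk $\Delta(W)=[W,W,\dots]$ has cost at most $6\,\mathrm{OPT}_G$.
   Context: A metric graph is a complete undirected graph with positive edge lengths satisfying the triangle inequality. A walk of size $k$ is a sequence of $k$ vertices with consecutive vertices adjacent; its length is the sum of its edge lengths. For an infinite walk $M$, the latency $L(M,v)$ is the maximum length of the sub-walk between consecutive occurrences of $v$ ($+\infty$ if $v$ does not occur infinitely often); the cost is $C(M)=\max_v\phi(v)L(M,v)$; $\mathrm{OPT}_G$ is the minimum cost over all infinite walks in $G$. *)

theory Defs
  imports Complex_Main "HOL-Library.Extended_Real" "HOL-Library.Landau_Symbols"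
begin

text \<open>
  A metric graph is given by its finite nonempty vertex set \<open>V\<close> and the edge lengths \<open>d\<close>.
  The graph is complete and has no loops, so two vertices are adjacent iff they are distinct, and
  only values of \<open>d\<close> on pairs of distinct vertices are constrained.
\<close>

definition adjacent :: "'a set \<Rightarrow> 'a \<Rightarrow> 'a \<Rightarrow> bool" where
  "adjacent V x y \<longleftrightarrow> x \<in> V \<and> y \<in> V \<and> x \<noteq> y"

definition metric_graph :: "'a set \<Rightarrow> ('a \<Rightarrow> 'a \<Rightarrow> real) \<Rightarrow> bool" where
  "metric_graph V d \<longleftrightarrow>
     finite V \<and> V \<noteq> {} \<and>
     (\<forall>x y. adjacent V x y \<longrightarrow> d x y > 0 \<and> d x y = d y x) \<and>
     (\<forall>x y z. adjacent V x y \<and> adjacent V y z \<and> adjacent V x z \<longrightarrow> d x z \<le> d x y + d y z)"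

definition walk :: "'a set \<Rightarrow> 'a list \<Rightarrow> bool" where
  "walk V W \<longleftrightarrow> W \<noteq> [] \<and> set W \<subseteq> V \<and> successively (adjacent V) W"

text \<open>Since there are no loops, infinite walks exist only if \<open>V\<close> has at least two vertices.\<close>

definition infinite_walk :: "'a set \<Rightarrow> (nat \<Rightarrow> 'a) \<Rightarrow> bool" where
  "infinite_walk V M \<longleftrightarrow> (\<forall>i. adjacent V (M i) (M (Suc i)))"

definition subwalk_length :: "('a \<Rightarrow> 'a \<Rightarrow> real) \<Rightarrow> (nat \<Rightarrow> 'a) \<Rightarrow> nat \<Rightarrow> nat \<Rightarrow> real" where
  "subwalk_length d M i j = (\<Sum>k = i..<j. d (M k) (M (Suc k)))"

definition consecutive_occurrences :: "(nat \<Rightarrow> 'a) \<Rightarrow> 'a \<Rightarrow> (nat \<times> nat) set" where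
  "consecutive_occurrences M v =
     {(i, j). i < j \<and> M i = v \<and> M j = v \<and> (\<forall>k. i < k \<and> k < j \<longrightarrow> M k \<noteq> v)}"

text \<open>The supremum is \<open>\<infinity>\<close> when the lengths are unbounded; otherwise it is a maximum, since a
  bounded set of lengths of walks in a finite graph with positive edge lengths is finite.\<close>

definition latency :: "('a \<Rightarrow> 'a \<Rightarrow> real) \<Rightarrow> (nat \<Rightarrow> 'a) \<Rightarrow> 'a \<Rightarrow> ereal" where
  "latency d M v =
     (if infinite {i. M i = v}
      then (SUP (i, j) \<in> consecutive_occurrences M v. ereal (subwalk_length d M i j))
      else \<infinity>)"

definition cost :: "'a set \<Rightarrow> ('a \<Rightarrow> 'a \<Rightarrow> real) \<Rightarrow> ('a \<Rightarrow> real) \<Rightarrow> (nat \<Rightarrow> 'a) \<Rightarrow> ereal" where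
  "cost V d \<phi> M = Max ((\<lambda>v. ereal (\<phi> v) * latency d M v) ` V)"

text \<open>For a metric graph with positive weights and at least two vertices the infimum is attained:
  by the same finiteness, only finitely many costs lie below a given real bound.\<close>

definition OPT :: "'a set \<Rightarrow> ('a \<Rightarrow> 'a \<Rightarrow> real) \<Rightarrow> ('a \<Rightarrow> real) \<Rightarrow> ereal" where
  "OPT V d \<phi> = (INF M \<in> {M. infinite_walk V M}. cost V d \<phi> M)"

definition Delta :: "'a list \<Rightarrow> nat \<Rightarrow> 'a" where
  "Delta W i = W ! (i mod length W)"

end

theory Submission imports Defs begin

text \<open>
  Let \<open>M\<close> have cost at most \<open>C\<close>, let \<open>u\<close> have weight \<open>1\<close>, \<open>n = N + 1\<close>, and \<open>T v = C / \<phi> v\<close>, so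
  that \<open>M\<close> visits \<open>v\<close> within every stretch of length \<open>T v\<close>. Mark visits \<open>p 0 < p 1 < \<dots>\<close> of \<open>u\<close>
  greedily, each as far as possible but at distance at most \<open>C\<close> from the previous one; two
  consecutive steps then have length more than \<open>C\<close>. Cut the window from \<open>p 0\<close> to \<open>p (2 N)\<close> out of
  \<open>M\<close>, keep in each step only the first visit to every vertex (at most \<open>2 N n\<close> visits, and no
  distance grows), and insert at the beginning of every second step a round trip from \<open>u\<close> to
  another vertex, a different one each time; such a trip has length at most \<open>C\<close>. Repeat
  this closed walk forever.

  Its period is at most \<open>3 N C\<close>, which suffices for vertices with \<open>T v \<ge> N C\<close>. For the others, a gap
  across the end of the window has length at most \<open>T v + C\<close> before the end of the window and \<open>T v\<close>
  after it, and as the round trips lie more than \<open>C\<close> apart, those in between add at most \<open>2 T v + C\<close>;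
  in total this is \<open>4 T v + 2 C \<le> 6 T v\<close>. Gaps inside the window are shorter. Finally, only
  finitely many walks have size at most \<open>2 n\<^sup>2\<close>, so the best of them is within factor \<open>6\<close> of every
  \<open>M\<close>, hence of the infimum.
\<close>

section \<open>Walk lengths and latencies\<close>

text \<open>\<open>d\<close> is unconstrained on equal arguments; with the value 0 there, the
  triangle inequality also covers repeated vertices.\<close>

definition loop_dist :: "('a \<Rightarrow> 'a \<Rightarrow> real) \<Rightarrow> 'a \<Rightarrow> 'a \<Rightarrow> real" where
  "loop_dist d x y = (if x = y then 0 else d x y)"

lemma metric_graphD:
  assumes "metric_graph V d"
  shows "finite V" "V \<noteq> {}"
    "adjacent V x y \<Longrightarrow> 0 < d x y"
    "adjacent V x y \<Longrightarrow> d x y = d y x"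
    "\<lbrakk>adjacent V x y; adjacent V y z; adjacent V x z\<rbrakk> \<Longrightarrow> d x z \<le> d x y + d y z"
  using assms unfolding metric_graph_def by blast+

lemma loop_dist_nonneg:
  assumes "metric_graph V d" "x \<in> V" "y \<in> V"
  shows "0 \<le> loop_dist d x y"
  using metric_graphD(3)[OF assms(1), of x y] assms
  by (auto simp: loop_dist_def adjacent_def)

lemma loop_dist_triangle:
  assumes "metric_graph V d" "x \<in> V" "y \<in> V" "z \<in> V"
  shows "loop_dist d x z \<le> loop_dist d x y + loop_dist d y z"
proof (cases "x = y \<or> y = z \<or> x = z")
  case True
  then show ?thesis
    using loop_dist_nonneg[of V d x y] loop_dist_nonneg[of V d y z] assms
    by (auto simp: loop_dist_def)
next
  case False
  then show ?thesis
    using metric_graphD(5)[OF assms(1), of x y z] assms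
    by (auto simp: loop_dist_def adjacent_def)
qed

lemma loop_dist_le_clock:
  assumes G: "metric_graph V d" and V: "\<And>n. y n \<in> V"
    and step: "\<And>n. loop_dist d (y n) (y (Suc n)) \<le> \<sigma> (Suc n) - \<sigma> n"
    and "n \<le> m"
  shows "loop_dist d (y n) (y m) \<le> \<sigma> m - \<sigma> n"
  using \<open>n \<le> m\<close>
proof (induction m rule: dec_induct)
  case base
  then show ?case by (simp add: loop_dist_def)
next
  case (step m)
  show ?case
    using loop_dist_triangle[OF G V V V, of n "Suc m" m] assms(3)[of m] step.IH by linarith
qed

lemma subwalk_length_Suc:
  "i \<le> j \<Longrightarrow> subwalk_length d M i (Suc j) = subwalk_length d M i j + d (M j) (M (Suc j))"
  by (simp add: subwalk_length_def)

lemma subwalk_length_split: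
  "\<lbrakk>i \<le> j; j \<le> k\<rbrakk> \<Longrightarrow> subwalk_length d M i k = subwalk_length d M i j + subwalk_length d M j k"
  by (simp add: subwalk_length_def sum.atLeastLessThan_concat)

lemma infinite_walk_in: "infinite_walk V M \<Longrightarrow> M i \<in> V"
  by (auto simp: infinite_walk_def adjacent_def)

lemma subwalk_length_nonneg:
  assumes "metric_graph V d" "infinite_walk V M"
  shows "0 \<le> subwalk_length d M i j"
  unfolding subwalk_length_def using assms metric_graphD(3)[OF assms(1)]
  by (intro sum_nonneg) (auto simp: infinite_walk_def intro: less_imp_le)

text \<open>The returns in \<open>recur\<close> need not be consecutive: any later visit lies at or
  beyond the next one, and lengths are nonnegative.\<close>

lemma latency_le:
  assumes G: "metric_graph V d" and M: "infinite_walk V M" and "M i0 = v"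
    and recur: "\<And>i. M i = v \<Longrightarrow> \<exists>j>i. M j = v \<and> subwalk_length d M i j \<le> B"
  shows "latency d M v \<le> ereal B"
proof -
  have inf: "infinite {i. M i = v}"
  proof
    assume fin: "finite {i. M i = v}"
    then have "M (Max {i. M i = v}) = v"
      using Max_in[OF fin] \<open>M i0 = v\<close> by blast
    then obtain j where "j > Max {i. M i = v}" "M j = v" using recur by blast
    then show False using Max_ge[OF fin, of j] by auto
  qed
  have "subwalk_length d M i j \<le> B" if ij: "(i, j) \<in> consecutive_occurrences M v" for i j
  proof -
    obtain j' where j': "j' > i" "M j' = v" "subwalk_length d M i j' \<le> B"
      using ij recur unfolding consecutive_occurrences_def by blast
    then have "j \<le> j'" "i \<le> j"
      using ij unfolding consecutive_occurrences_def by force+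
    then show ?thesis
      using subwalk_length_split[of i j j' d M] subwalk_length_nonneg[OF G M, of j j'] j' by linarith
  qed
  then show ?thesis
    using inf unfolding latency_def by (auto intro!: SUP_least)
qed

text \<open>
  The events \<open>I\<close> are ordered by index; event \<open>n\<close> takes place at vertex \<open>y n\<close> at time \<open>\<sigma> n\<close>, and the
  schedule repeats with period \<open>P\<close>. Since the times obey the distances, events may be dropped at will.
\<close>

lemma schedule_walk:
  fixes I :: "nat set" and y :: "nat \<Rightarrow> 'a" and \<sigma> :: "nat \<Rightarrow> real"
  assumes G: "metric_graph V d" and fin: "finite I" and ne: "I \<noteq> {}"
    and V: "\<And>n. n \<in> I \<Longrightarrow> y n \<in> V"
    and lip: "\<And>n m. \<lbrakk>n \<in> I; m \<in> I; n < m\<rbrakk> \<Longrightarrow> loop_dist d (y n) (y m) \<le> \<sigma> m - \<sigma> n"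
    and lip_wrap: "\<And>n m. \<lbrakk>n \<in> I; m \<in> I\<rbrakk> \<Longrightarrow> loop_dist d (y n) (y m) \<le> \<sigma> m + P - \<sigma> n"
    and sep: "\<And>n m. \<lbrakk>n \<in> I; m \<in> I; n < m; y n = y m\<rbrakk> \<Longrightarrow> \<exists>l\<in>I. n < l \<and> l < m"
    and sep_wrap: "\<And>n m. \<lbrakk>n \<in> I; m \<in> I; \<forall>l\<in>I. m \<le> l \<and> l \<le> n\<rbrakk> \<Longrightarrow> y n \<noteq> y m"
    and gap: "\<And>n. n \<in> I \<Longrightarrow> \<exists>m\<in>I. y m = y n \<and>
                (n < m \<and> \<sigma> m \<le> \<sigma> n + B (y n) \<or> \<sigma> m + P \<le> \<sigma> n + B (y n))"
  shows "\<exists>W. walk V W \<and> length W = card I \<and> infinite_walk V (Delta W) \<and>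
             (\<forall>v\<in>y ` I. latency d (Delta W) v \<le> ereal (B v))"
proof -
  define ts where "ts = sorted_list_of_set I"
  define m where "m = length ts"
  define W where "W = map y ts"
  define time where "time i = \<sigma> (ts ! (i mod m)) + P * real (i div m)" for i
  have set_ts: "set ts = I" using fin by (simp add: ts_def)
  have m_card: "m = card I" by (simp add: m_def ts_def)
  have m_pos: "0 < m" using fin ne by (simp add: m_card card_gt_0_iff)
  have mono: "ts ! a < ts ! b \<longleftrightarrow> a < b" if "a < m" "b < m" for a b
  proof -
    have "sorted_wrt (<) ts" by (simp add: ts_def)
    then have "\<And>a b. \<lbrakk>a < b; b < m\<rbrakk> \<Longrightarrow> ts ! a < ts ! b"
      unfolding m_def by (rule sorted_wrt_nth_less)
    then show ?thesis using that by (metis linorder_neqE_nat not_less_iff_gr_or_eq)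
  qed
  have mem: "ts ! a \<in> I" if "a < m" for a using that set_ts nth_mem m_def by blast
  have ex: "\<exists>a<m. ts ! a = n" if "n \<in> I" for n
    using that set_ts in_set_conv_nth[of n ts] m_def by auto
  have Delta: "Delta W i = y (ts ! (i mod m))" for i
    using m_pos by (simp add: Delta_def W_def m_def)
  have nextI: "Delta W i \<noteq> Delta W (Suc i) \<and>
      loop_dist d (Delta W i) (Delta W (Suc i)) \<le> time (Suc i) - time i" for i
  proof (cases "Suc (i mod m) = m")
    case True
    then have mod: "Suc i mod m = 0" "Suc i div m = Suc (i div m)"
      by (simp_all add: mod_Suc div_Suc)
    have last: "ts ! 0 \<le> l \<and> l \<le> ts ! (i mod m)" if "l \<in> I" for l
    proof -
      obtain a where "a < m" "ts ! a = l" using ex[OF \<open>l \<in> I\<close>] by blast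
      then show ?thesis
        using mono[of a 0] mono[of "i mod m" a] m_pos True by simp
    qed
    have "Delta W i \<noteq> Delta W (Suc i)"
      unfolding Delta mod using sep_wrap[of "ts ! (i mod m)" "ts ! 0"] last mem m_pos by auto
    moreover have "loop_dist d (Delta W i) (Delta W (Suc i)) \<le> time (Suc i) - time i"
      unfolding Delta time_def mod using lip_wrap[of "ts ! (i mod m)" "ts ! 0"] mem m_pos
      by (auto simp: algebra_simps)
    ultimately show ?thesis by blast
  next
    case False
    then have mod: "Suc i mod m = Suc (i mod m)" "Suc i div m = i div m"
      by (simp_all add: mod_Suc div_Suc)
    have lt: "Suc (i mod m) < m" using False m_pos by (simp add: Suc_lessI)
    \<comment> \<open>Neighbours in the sorted list have no event between them, so
      \<open>sep\<close> forces their vertices to differ.\<close>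
    have "\<not> (\<exists>l\<in>I. ts ! (i mod m) < l \<and> l < ts ! Suc (i mod m))"
    proof
      assume "\<exists>l\<in>I. ts ! (i mod m) < l \<and> l < ts ! Suc (i mod m)"
      then obtain a where "a < m" "ts ! (i mod m) < ts ! a" "ts ! a < ts ! Suc (i mod m)"
        using ex by blast
      then show False using mono[of "i mod m" a] mono[of a "Suc (i mod m)"] lt by simp
    qed
    then have "Delta W i \<noteq> Delta W (Suc i)"
      unfolding Delta mod using sep[of "ts ! (i mod m)" "ts ! Suc (i mod m)"] mem lt mono by auto
    moreover have "loop_dist d (Delta W i) (Delta W (Suc i)) \<le> time (Suc i) - time i"
      unfolding Delta time_def mod using lip[of "ts ! (i mod m)" "ts ! Suc (i mod m)"] mem lt mono
      by auto
    ultimately show ?thesis by blast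
  qed
  have DV: "Delta W i \<in> V" for i using Delta V mem m_pos by simp
  have inf: "infinite_walk V (Delta W)"
    using DV nextI by (auto simp: infinite_walk_def adjacent_def)
  have walk: "walk V W"
    unfolding walk_def successively_conv_nth
  proof (intro conjI allI impI)
    show "W \<noteq> []" using m_pos by (auto simp: W_def m_def)
    show "set W \<subseteq> V" using V by (auto simp: W_def set_ts)
    fix i assume "Suc i < length W"
    then show "adjacent V (W ! i) (W ! Suc i)"
      using inf[unfolded infinite_walk_def, rule_format, of i] by (simp add: Delta_def)
  qed
  have len: "subwalk_length d (Delta W) i j \<le> time j - time i" if "i \<le> j" for i j
    using that
  proof (induction j rule: dec_induct)
    case base
    then show ?case by (simp add: subwalk_length_def)
  next
    case (step j)
    then show ?case using nextI[of j] by (auto simp: subwalk_length_Suc loop_dist_def)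
  qed
  have "latency d (Delta W) v \<le> ereal (B v)" if "v \<in> y ` I" for v
  proof -
    obtain a where a: "a < m" "y (ts ! a) = v" using \<open>v \<in> y ` I\<close> ex by blast
    show ?thesis
    proof (rule latency_le[OF G inf, of a])
      show "Delta W a = v" using a by (simp add: Delta)
      fix i assume i: "Delta W i = v"
      obtain n where n: "n \<in> I" "y n = v"
        "ts ! (i mod m) < n \<and> \<sigma> n \<le> \<sigma> (ts ! (i mod m)) + B v \<or>
         \<sigma> n + P \<le> \<sigma> (ts ! (i mod m)) + B v"
        using gap[of "ts ! (i mod m)"] i mem m_pos unfolding Delta by auto
      obtain b where b: "b < m" "ts ! b = n" using ex n by blast
      \<comment> \<open>The event \<open>n\<close> is taken in the current repetition if the first
        alternative of \<open>gap\<close> applies, and otherwise in the next one.\<close>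
      define j where "j = (if i mod m < b \<and> \<sigma> n \<le> \<sigma> (ts ! (i mod m)) + B v
        then i div m * m + b else Suc (i div m) * m + b)"
      have jb: "j mod m = b" using b by (auto simp only: j_def mod_mult_self3 mod_less split: if_split)
      have ij: "i < j"
      proof -
        have "i div m * m + i mod m = i" "i mod m < m" using m_pos by simp_all
        then show ?thesis unfolding j_def mult_Suc by (split if_split) linarith
      qed
      have jd: "j div m = (if i mod m < b \<and> \<sigma> n \<le> \<sigma> (ts ! (i mod m)) + B v
        then i div m else Suc (i div m))"
        using b by (auto simp only: j_def div_mult_self3 div_less add_0_right split: if_split)
      have "time j - time i \<le> B v"
        using n b mono[of "i mod m" b] m_pos
        by (auto simp: time_def jb jd algebra_simps)
      then show "\<exists>j>i. Delta W j = v \<and> subwalk_length d (Delta W) i j \<le> B v"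
        using len[of i j] ij n b jb by (intro exI[of _ j]) (auto simp: Delta)
    qed
  qed
  then show ?thesis
    using walk inf by (intro exI[of _ W]) (auto simp: W_def m_def[symmetric] m_card)
qed


section \<open>Walks with bounded return distances\<close>

text \<open>\<open>visit\<close> starts from every position, not only from visits to
  \<open>v\<close>; a late enough tail has this property by \<open>frequent_visits\<close>.\<close>

locale frequent_walk =
  fixes V :: "'a set" and d :: "'a \<Rightarrow> 'a \<Rightarrow> real" and M :: "nat \<Rightarrow> 'a"
    and u :: 'a and C :: real and T :: "'a \<Rightarrow> real"
  assumes graph: "metric_graph V d" and walk: "infinite_walk V M" and M_0: "M 0 = u"
    and visit: "v \<in> V \<Longrightarrow> \<exists>j>i. M j = v \<and> subwalk_length d M i j \<le> T v"
    and T_u: "T u = C" and T_ge: "v \<in> V \<Longrightarrow> C \<le> T v"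
begin

abbreviation dist_to :: "nat \<Rightarrow> real" where "dist_to \<equiv> subwalk_length d M 0"

lemma in_V: "M i \<in> V" by (rule infinite_walk_in[OF walk])

lemma u_in_V: "u \<in> V" using in_V[of 0] M_0 by simp

lemma dist_to_0: "dist_to 0 = 0" by (simp add: subwalk_length_def)

lemma dist_to_Suc: "dist_to (Suc i) = dist_to i + d (M i) (M (Suc i))"
  by (simp add: subwalk_length_Suc)

lemma M_Suc_neq: "M (Suc i) \<noteq> M i"
  using walk[unfolded infinite_walk_def, rule_format, of i] by (auto simp: adjacent_def)

lemma strict_mono_dist_to: "strict_mono dist_to"
  using walk metric_graphD(3)[OF graph]
  by (auto simp: strict_mono_Suc_iff dist_to_Suc infinite_walk_def)

lemma dist_to_le_iff: "dist_to i \<le> dist_to j \<longleftrightarrow> i \<le> j"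
  by (rule strict_mono_less_eq[OF strict_mono_dist_to])

lemma dist_to_less_iff: "dist_to i < dist_to j \<longleftrightarrow> i < j"
  by (rule strict_mono_less[OF strict_mono_dist_to])

lemma visit':
  assumes "v \<in> V"
  shows "\<exists>j>i. M j = v \<and> dist_to j - dist_to i \<le> T v"
proof -
  obtain j where j: "j > i" "M j = v" "subwalk_length d M i j \<le> T v"
    using visit[OF assms] by blast
  moreover have "dist_to j = dist_to i + subwalk_length d M i j"
    using j by (intro subwalk_length_split) simp_all
  ultimately show ?thesis by auto
qed

lemma C_pos: "0 < C"
proof -
  obtain j where "j > 0" "dist_to j - dist_to 0 \<le> T u" using visit' u_in_V by blast
  then show ?thesis using dist_to_less_iff[of 0 j] T_u by simp
qed

lemma loop_dist_le_dist_to: "i \<le> j \<Longrightarrow> loop_dist d (M i) (M j) \<le> dist_to j - dist_to i"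
  by (rule loop_dist_le_clock[OF graph in_V]) (auto simp: dist_to_Suc loop_dist_def M_Suc_neq[symmetric])

text \<open>\<open>M\<close> visits \<open>v\<close> at some point; the last visit to
  \<open>u\<close> up to there and the next one within \<open>C\<close> enclose it, and distances
  are at most lengths along \<open>M\<close>.\<close>

lemma round_trip:
  assumes "v \<in> V"
  shows "loop_dist d u v + loop_dist d v u \<le> C"
proof -
  obtain i where i: "M i = v" using visit[OF assms] by blast
  define i1 where "i1 = (GREATEST k. k \<le> i \<and> M k = u)"
  have i1: "i1 \<le> i \<and> M i1 = u"
    unfolding i1_def by (rule GreatestI_nat[of _ 0 i]) (auto simp: M_0)
  obtain j where j: "j > i1" "M j = u" "dist_to j - dist_to i1 \<le> C"
    using visit'[OF u_in_V] T_u by metis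
  have "j > i"
  proof (rule ccontr)
    assume "\<not> j > i"
    then have "j \<le> i1"
      unfolding i1_def by (intro Greatest_le_nat[of _ _ i]) (auto simp: j)
    then show False using j by simp
  qed
  then show ?thesis
    using loop_dist_le_dist_to[of i1 i] loop_dist_le_dist_to[of i j] i i1 j by simp
qed

text \<open>The shortest of the finitely many edges has positive length \<delta>, so
  \<open>dist_to j\<close> is at least \<delta> times \<open>j\<close>.\<close>

lemma finite_dist_to_le: "finite {j. dist_to j \<le> r}"
proof -
  define E where "E = {(x, y). adjacent V x y}"
  have "finite E"
    using metric_graphD(1)[OF graph]
    by (intro finite_subset[of E "V \<times> V"]) (auto simp: E_def adjacent_def)
  then have fin: "finite (case_prod d ` E)" by simp
  have step: "(M i, M (Suc i)) \<in> E" for i using walk by (auto simp: E_def infinite_walk_def)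
  define \<delta> where "\<delta> = Min (case_prod d ` E)"
  have "\<delta> \<in> case_prod d ` E" unfolding \<delta>_def using fin step by (intro Min_in) auto
  then have pos: "0 < \<delta>" using metric_graphD(3)[OF graph] by (auto simp: E_def)
  have "\<delta> * real j \<le> dist_to j" for j
  proof (induction j)
    case (Suc j)
    have "\<delta> \<le> d (M j) (M (Suc j))"
      unfolding \<delta>_def using fin step[of j] by (intro Min_le) (auto intro: image_eqI[of _ _ "(M j, M (Suc j))"])
    then show ?case using Suc by (simp add: dist_to_Suc algebra_simps)
  qed (simp add: dist_to_0)
  then have "real j \<le> r / \<delta>" if "dist_to j \<le> r" for j
    using order_trans[OF _ that] pos by (simp add: field_simps)
  then have "real j \<le> real (nat \<lceil>r / \<delta>\<rceil>)" if "dist_to j \<le> r" for j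
    using that real_nat_ceiling_ge order_trans by blast
  then have "{j. dist_to j \<le> r} \<subseteq> {..nat \<lceil>r / \<delta>\<rceil>}" by auto
  then show ?thesis by (rule finite_subset) simp
qed

text \<open>The greedy choice of the next mark, a maximum over a finite set. The last conjunct makes
  two consecutive steps longer than \<open>C\<close>.\<close>

lemma farthest_return:
  assumes "M i = u"
  shows "\<exists>j>i. M j = u \<and> dist_to j - dist_to i \<le> C \<and>
           (\<forall>j'>j. M j' = u \<longrightarrow> C < dist_to j' - dist_to i)"
proof -
  define S where "S = {j. j > i \<and> M j = u \<and> dist_to j - dist_to i \<le> C}"
  have "finite S"
    by (rule finite_subset[OF _ finite_dist_to_le[of "dist_to i + C"]]) (auto simp: S_def)
  moreover have "S \<noteq> {}" using visit'[OF u_in_V, of i] T_u by (auto simp: S_def)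
  ultimately have "Max S \<in> S" and max: "\<And>j. j \<in> S \<Longrightarrow> j \<le> Max S" by simp_all
  moreover have "C < dist_to j - dist_to i" if "j > Max S" "M j = u" for j
    using max[of j] that \<open>Max S \<in> S\<close> by (force simp: S_def)
  ultimately show ?thesis by (auto simp: S_def)
qed

end

section \<open>The periodic walk of a marked walk\<close>

text \<open>On \<open>{..<N}\<close> the function \<open>w\<close> lists the turning points of the
  round trips; beyond that it only has to stay in \<open>V - {u}\<close>, so that every index has a
  stop.\<close>

locale marked_walk = frequent_walk +
  fixes p :: "nat \<Rightarrow> nat" and w :: "nat \<Rightarrow> 'a" and N :: nat
  assumes p_0: "p 0 = 0" and M_p: "M (p k) = u" and p_less: "p k < p (Suc k)"
    and step_le: "dist_to (p (Suc k)) - dist_to (p k) \<le> C"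
    and two_steps: "C < dist_to (p (Suc (Suc k))) - dist_to (p k)"
    and N_pos: "0 < N" and w_image: "w ` {..<N} = V - {u}" and w_in: "w a \<in> V - {u}"
begin

lemma strict_mono_p: "strict_mono p"
  by (simp add: strict_mono_Suc_iff p_less)

lemma p_less_iff: "p a < p b \<longleftrightarrow> a < b" by (rule strict_mono_less[OF strict_mono_p])
lemma p_le_iff: "p a \<le> p b \<longleftrightarrow> a \<le> b" by (rule strict_mono_less_eq[OF strict_mono_p])

lemma spread: "a \<le> b \<Longrightarrow> C * real b - C * real a \<le> dist_to (p (2 * b)) - dist_to (p (2 * a))"
proof (induction b rule: dec_induct)
  case (step b)
  then show ?case using two_steps[of "2 * b"] by (simp add: algebra_simps)
qed simp

lemma dist_to_p_le: "dist_to (p k) \<le> C * real k"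
proof (induction k)
  case (Suc k)
  then show ?case using step_le[of k] by (simp add: algebra_simps)
qed (simp add: p_0 dist_to_0)

lemma enclosing: "\<exists>k. p k \<le> i \<and> i < p (Suc k)"
proof -
  have "\<exists>k. i < p k"
    using strict_mono_imp_increasing[OF strict_mono_p, of "Suc i"] by (metis Suc_le_lessD)
  define k where "k = (LEAST k. i < p k)"
  have k: "i < p k" unfolding k_def using \<open>\<exists>k. i < p k\<close> by (rule LeastI_ex)
  then obtain k' where k': "k = Suc k'" using p_0 by (cases k) auto
  have "\<not> i < p k'" using not_less_Least[of k' "\<lambda>k. i < p k"] k' k_def by simp
  then show ?thesis using k k' by (intro exI[of _ k']) simp
qed

section \<open>Counting the round trips\<close>

definition detours :: "nat \<Rightarrow> nat" where
  "detours i = (LEAST a. i \<le> p (2 * a))"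

text \<open>As \<open>p\<close> increases, the \<open>a\<close> with \<open>p (2 * a) < i\<close>
  form an initial segment of the naturals, and \<open>detours i\<close> is its length.\<close>

lemma less_detours_iff: "a < detours i \<longleftrightarrow> p (2 * a) < i"
proof
  assume "a < detours i"
  then show "p (2 * a) < i"
    using not_less_Least[of a "\<lambda>a. i \<le> p (2 * a)"] by (simp add: detours_def)
next
  assume less: "p (2 * a) < i"
  have "i \<le> p i" by (rule strict_mono_imp_increasing[OF strict_mono_p])
  also have "p i \<le> p (2 * i)" by (simp add: p_le_iff)
  finally have "i \<le> p (2 * detours i)" unfolding detours_def by (rule LeastI)
  then have "p (2 * a) < p (2 * detours i)" using less by simp
  then show "a < detours i" by (simp add: p_less_iff)
qed

lemma detours_eqI: "(\<And>a. p (2 * a) < i \<longleftrightarrow> a < b) \<Longrightarrow> detours i = b"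
  using less_detours_iff[of _ i] by (metis nat_neq_iff)

lemma detours_p: "detours (p (2 * a)) = a"
  by (rule detours_eqI) (simp add: p_less_iff)

lemma detours_Suc_p: "detours (Suc (p (2 * a))) = Suc a"
  by (rule detours_eqI) (simp add: p_le_iff less_Suc_eq_le)

lemma detours_Suc: "i \<notin> range (\<lambda>a. p (2 * a)) \<Longrightarrow> detours (Suc i) = detours i"
  by (rule detours_eqI) (auto simp: less_detours_iff less_Suc_eq)

text \<open>
  Position \<open>i\<close> of \<open>M\<close> is split into the indices \<open>3 i\<close>, \<open>3 i + 1\<close>, \<open>3 i + 2\<close>; if a round trip starts at
  position \<open>i\<close>, these are its start, its turning point and its end. The first \<open>detours i\<close> round trips
  start before position \<open>i\<close>.
\<close>

definition stop :: "nat \<Rightarrow> 'a" where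
  "stop n = (if n mod 3 = 1 \<and> n div 3 \<in> range (\<lambda>a. p (2 * a))
     then w (detours (n div 3)) else M (n div 3))"

text \<open>Every completed round trip is charged \<open>C\<close>, whatever its true length; at a
  turning point the current trip is charged only its way out.\<close>

definition clock :: "nat \<Rightarrow> real" where
  "clock n = dist_to (n div 3) +
     (if n mod 3 = 2 then C * real (detours (Suc (n div 3)))
      else C * real (detours (n div 3)) +
        (if n mod 3 = 1 then loop_dist d (M (n div 3)) (stop n) else 0))"

lemma triple_div_mod:
  "Suc (3 * i) div 3 = i" "Suc (Suc (3 * i)) div 3 = i"
  "Suc (3 * i) mod 3 = Suc 0" "Suc (Suc (3 * i)) mod 3 = (2 :: nat)" for i :: nat
  by presburger+

lemma stop_simps:
  "stop (3 * i) = M i" "stop (Suc (Suc (3 * i))) = M i"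
  "stop (Suc (3 * i)) = (if i \<in> range (\<lambda>a. p (2 * a)) then w (detours i) else M i)"
  by (simp_all add: stop_def triple_div_mod)

lemma clock_simps:
  "clock (3 * i) = dist_to i + C * real (detours i)"
  "clock (Suc (3 * i)) = dist_to i + C * real (detours i) + loop_dist d (M i) (stop (Suc (3 * i)))"
  "clock (Suc (Suc (3 * i))) = dist_to i + C * real (detours (Suc i))"
  by (simp_all add: clock_def triple_div_mod)

lemma stop_0: "stop 0 = u"
  using stop_simps(1)[of 0] M_0 by simp

lemma mod3_cases:
  obtains (0) i where "n = 3 * i" | (1) i where "n = Suc (3 * i)" | (2) i where "n = Suc (Suc (3 * i))"
proof -
  have "n = 3 * (n div 3) \<or> n = Suc (3 * (n div 3)) \<or> n = Suc (Suc (3 * (n div 3)))"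
    by presburger
  then show thesis using 0 1 2 by blast
qed

lemma stop_in_V: "stop n \<in> V"
  using in_V w_in by (auto simp: stop_def)

lemma stop_clock_Suc: "loop_dist d (stop n) (stop (Suc n)) \<le> clock (Suc n) - clock n"
proof (cases n rule: mod3_cases)
  case (0 i)
  then show ?thesis by (simp add: stop_simps(1) clock_simps)
next
  case (1 i)
  show ?thesis
  proof (cases "i \<in> range (\<lambda>a. p (2 * a))")
    case True
    then obtain a where a: "i = p (2 * a)" by blast
    \<comment> \<open>The way out is on the clock already, so what is left of \<open>C\<close>
      covers the way back.\<close>
    show ?thesis
      using round_trip[of "w a"] w_in[of a] 1
      by (auto simp: stop_simps clock_simps a detours_p detours_Suc_p M_p distrib_left)
  next
    case False
    then show ?thesis
      using 1 by (simp add: stop_simps clock_simps detours_Suc loop_dist_def)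
  qed
next
  case (2 i)
  then have "Suc n = 3 * Suc i" by simp
  then show ?thesis
    using 2 M_Suc_neq[of i]
    by (simp only: stop_simps clock_simps) (simp add: dist_to_Suc loop_dist_def)
qed

lemma stop_clock: "n \<le> m \<Longrightarrow> loop_dist d (stop n) (stop m) \<le> clock m - clock n"
  by (rule loop_dist_le_clock[where y = stop and \<sigma> = clock, OF graph stop_in_V stop_clock_Suc])

section \<open>Kept visits and events\<close>

text \<open>A mark between \<open>i\<close> and each earlier visit to its vertex expresses that
  \<open>i\<close> is the first such visit in its step, without naming the step.\<close>

definition kept :: "nat \<Rightarrow> bool" where
  "kept i \<longleftrightarrow> i < p (2 * N) \<and> (\<forall>i'<i. M i' = M i \<longrightarrow> (\<exists>k. i' < p k \<and> p k \<le> i))"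

definition events :: "nat set" where
  "events = (\<lambda>i. 3 * i) ` {i. kept i} \<union>
     (\<lambda>a. Suc (3 * p (2 * a))) ` {..<N} \<union> (\<lambda>a. Suc (Suc (3 * p (2 * a)))) ` {..<N}"

text \<open>The clock at the end of the window, at \<open>u\<close> with all \<open>N\<close> trips
  done; this moment is event 0 of the next repetition.\<close>

abbreviation period :: real where "period \<equiv> clock (3 * p (2 * N))"

lemma kept_p: "k < 2 * N \<Longrightarrow> kept (p k)"
  by (auto simp: kept_def p_less_iff)

text \<open>An earlier visit to \<open>M f\<close> can only lie before \<open>p k\<close>, so this
  mark separates it from \<open>f\<close>.\<close>

lemma kept_first_since:
  assumes "p k \<le> f" "f < p (2 * N)" "\<And>i. \<lbrakk>p k \<le> i; i < f\<rbrakk> \<Longrightarrow> M i \<noteq> M f"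
  shows "kept f"
  using assms unfolding kept_def by (meson not_le)

text \<open>Each step begins with a visit to \<open>u\<close>, its mark, so no other visit to
  \<open>u\<close> in the step is kept.\<close>

lemma kept_u:
  assumes "kept i" "M i = u"
  shows "\<exists>k<2*N. i = p k"
proof -
  obtain k where k: "p k \<le> i" "i < p (Suc k)" using enclosing by blast
  have "p k = i"
  proof (rule ccontr)
    assume "p k \<noteq> i"
    then have "p k < i" using k by simp
    then obtain k' where k': "p k < p k'" "p k' \<le> i"
      using assms M_p unfolding kept_def by metis
    then show False using k p_less_iff p_le_iff by (metis less_le_trans Suc_leI not_le)
  qed
  moreover have "p k < p (2 * N)" using assms(1) k unfolding kept_def by linarith
  ultimately show ?thesis by (auto simp: p_less_iff)
qed

text \<open>Only the mark, which is at \<open>u\<close>, precedes this position in its step. The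
  resulting event keeps events at different marks apart.\<close>

lemma kept_Suc_p:
  assumes "k < 2 * N"
  shows "kept (Suc (p k))"
proof (rule kept_first_since[of k])
  have "Suc (p k) \<le> p (2 * N)" using assms p_less_iff by (simp add: Suc_le_eq)
  moreover have "Suc (p k) \<noteq> p (2 * N)" using M_Suc_neq[of "p k"] M_p by metis
  ultimately show "Suc (p k) < p (2 * N)" by simp
qed (use M_Suc_neq[of "p k"] in \<open>auto simp: less_Suc_eq\<close>)

lemma eventE:
  assumes "n \<in> events"
  obtains (kept) i where "n = 3 * i" "kept i"
    | (away) a where "a < N" "n = Suc (3 * p (2 * a))"
    | (home) a where "a < N" "n = Suc (Suc (3 * p (2 * a)))"
  using assms unfolding events_def by blast

lemma eventI:
  "kept i \<Longrightarrow> 3 * i \<in> events"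
  "a < N \<Longrightarrow> Suc (3 * p (2 * a)) \<in> events"
  "a < N \<Longrightarrow> Suc (Suc (3 * p (2 * a))) \<in> events"
  by (auto simp: events_def)

lemma event_less: "n \<in> events \<Longrightarrow> n < 3 * p (2 * N)"
proof (erule eventE)
  fix a assume "a < N"
  then have "p (2 * a) < p (2 * N)" by (simp add: p_less_iff)
  then show "n = Suc (3 * p (2 * a)) \<Longrightarrow> n < 3 * p (2 * N)"
    and "n = Suc (Suc (3 * p (2 * a))) \<Longrightarrow> n < 3 * p (2 * N)" by linarith+
qed (auto simp: kept_def)

lemma finite_events: "finite events"
  by (rule finite_subset[of _ "{..<3 * p (2 * N)}"]) (auto dest: event_less)

lemma stop_away: "stop (Suc (3 * p (2 * a))) = w a"
  by (simp add: stop_simps detours_p)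

lemma event_stop_u:
  assumes "n \<in> events" "stop n = u"
  shows "\<exists>k<2*N. n = 3 * p k \<or> (even k \<and> n = Suc (Suc (3 * p k)))"
  using assms(1)
proof (cases rule: eventE)
  case (kept i)
  then show ?thesis using kept_u assms(2) by (auto simp: stop_simps)
next
  case (away a)
  then show ?thesis using assms(2) w_in[of a] by (simp add: stop_away)
next
  case (home a)
  then show ?thesis by (intro exI[of _ "2 * a"]) simp
qed

lemma event_stop_not_u:
  assumes "n \<in> events" "stop n \<noteq> u"
  shows "(\<exists>i. n = 3 * i \<and> kept i) \<or> (\<exists>a<N. n = Suc (3 * p (2 * a)))"
  using assms(1)
proof (cases rule: eventE)
  case (home a)
  then show ?thesis using assms(2) by (simp add: stop_simps M_p)
qed blast+

text \<open>There are no loops, so neighbouring events must be at distinct vertices. Between two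
  events at \<open>u\<close> lies a turning point or the position after a mark; between two at
  another vertex, a mark or the end of a trip.\<close>

lemma separated:
  assumes "n \<in> events" "m \<in> events" "n < m" "stop n = stop m"
  shows "\<exists>l\<in>events. n < l \<and> l < m"
proof (cases "stop n = u")
  case True
  obtain k where k: "k < 2 * N" "n = 3 * p k \<or> (even k \<and> n = Suc (Suc (3 * p k)))"
    using event_stop_u[OF assms(1) True] by blast
  obtain k' where k': "k' < 2 * N" "m = 3 * p k' \<or> (even k' \<and> m = Suc (Suc (3 * p k')))"
    using event_stop_u[OF assms(2)] True assms(4) by auto
  show ?thesis
  proof (cases "k = k'")
    case True
    then obtain a where "k = 2 * a" using k k' \<open>n < m\<close> by (auto elim: evenE)
    then show ?thesis using k k' True \<open>n < m\<close> eventI(2)[of a] by (intro bexI[of _ "Suc (3 * p k)"]) auto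
  next
    case False
    have "\<not> p k' < p k" using k k' \<open>n < m\<close> by auto
    then have "p k < p k'" using False by (simp add: p_less_iff)
    moreover have "Suc (p k) \<noteq> p k'" using M_Suc_neq[of "p k"] M_p by metis
    ultimately have "Suc (p k) < p k'" by simp
    then show ?thesis
      using k k' eventI(1)[OF kept_Suc_p[OF k(1)]] by (intro bexI[of _ "3 * Suc (p k)"]) auto
  qed
next
  case False
  consider (kept) i i' where "n = 3 * i" "m = 3 * i'" "kept i'"
    | (away) a where "a < N" "n = Suc (3 * p (2 * a))"
    | (mixed) i a where "n = 3 * i" "a < N" "m = Suc (3 * p (2 * a))"
    using event_stop_not_u[OF assms(1) False] event_stop_not_u[OF assms(2)] False assms(4) by auto
  then show ?thesis
  proof cases
    case kept
    then have "i < i'" "M i = M i'" using assms by (auto simp: stop_simps)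
    then obtain k where k: "i < p k" "p k \<le> i'" using \<open>kept i'\<close> unfolding kept_def by blast
    moreover have "p k \<noteq> i'" using M_p False kept \<open>M i = M i'\<close> by (auto simp: stop_simps)
    moreover have "p k < p (2 * N)" using k \<open>kept i'\<close> unfolding kept_def by linarith
    ultimately show ?thesis
      using kept eventI(1)[OF kept_p[of k]] by (intro bexI[of _ "3 * p k"]) (auto simp: p_less_iff)
  next
    case away
    moreover have "m \<noteq> Suc (Suc (3 * p (2 * a)))"
      using False assms(4) by (auto simp: stop_simps M_p)
    ultimately show ?thesis
      using \<open>n < m\<close> eventI(3)[of a] by (intro bexI[of _ "Suc (Suc (3 * p (2 * a)))"]) auto
  next
    case mixed
    moreover have "i \<noteq> p (2 * a)" using False mixed by (auto simp: stop_simps M_p)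
    ultimately show ?thesis
      using \<open>n < m\<close> eventI(1)[OF kept_p[of "2 * a"]] by (intro bexI[of _ "3 * p (2 * a)"]) auto
  qed
qed

lemma zero_event: "0 \<in> events"
  using eventI(1)[OF kept_p[of 0]] N_pos by (simp add: p_0)

text \<open>The first event is at \<open>u\<close>; the last is not, as any event at
  \<open>u\<close> is followed by the kept position after its mark.\<close>

lemma separated_wrap:
  assumes "n \<in> events" "m \<in> events" "\<forall>l\<in>events. m \<le> l \<and> l \<le> n"
  shows "stop n \<noteq> stop m"
proof
  assume eq: "stop n = stop m"
  have "m = 0" using assms(3) zero_event by auto
  then have "stop n = u" using eq stop_0 by simp
  then obtain k where k: "k < 2 * N" "n = 3 * p k \<or> (even k \<and> n = Suc (Suc (3 * p k)))"
    using event_stop_u[OF assms(1)] by blast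
  have "3 * Suc (p k) \<in> events" by (rule eventI(1)[OF kept_Suc_p[OF k(1)]])
  then show False using assms(3) k(2) by fastforce
qed

lemma card_events: "card events \<le> 2 * N * card V + 2 * N"
proof -
  have finV: "finite V" by (rule metric_graphD(1)[OF graph])
  obtain h where h: "\<And>i. p (h i) \<le> i" "\<And>i. i < p (Suc (h i))" using enclosing by metis
  have "h i < 2 * N" if "kept i" for i
    using h(1)[of i] that p_less_iff[of "h i" "2 * N"] unfolding kept_def by linarith
  \<comment> \<open>Two kept positions with the same step and vertex would have a mark strictly
    inside the step.\<close>
  moreover have "inj_on (\<lambda>i. (h i, M i)) {i. kept i}"
  proof (rule linorder_inj_onI)
    fix i j assume ij: "i < j" "i \<in> {i. kept i}" "j \<in> {i. kept i}"
    show "(h i, M i) \<noteq> (h j, M j)"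
    proof
      assume eq: "(h i, M i) = (h j, M j)"
      then obtain k where "i < p k" "p k \<le> j" using ij unfolding kept_def by auto
      then have "p (h i) < p k" "p k < p (Suc (h i))" using h[of i] h[of j] eq by auto
      then show False by (simp add: p_less_iff)
    qed
  qed auto
  ultimately have "card {i. kept i} \<le> card ({..<2 * N} \<times> V)"
    using finV in_V by (intro card_inj_on_le[where f = "\<lambda>i. (h i, M i)"]) auto
  moreover have "finite {i. kept i}"
    by (rule finite_subset[of _ "{..<p (2 * N)}"]) (auto simp: kept_def)
  ultimately have "card ((\<lambda>i. 3 * i) ` {i. kept i}) \<le> 2 * N * card V"
    using card_image_le[of "{i. kept i}" "\<lambda>i. 3 * i"] by (simp add: card_cartesian_product)
  moreover have "card ((\<lambda>a. Suc (3 * p (2 * a))) ` {..<N}) \<le> N"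
    by (rule order_trans[OF card_image_le]) simp_all
  moreover have "card ((\<lambda>a. Suc (Suc (3 * p (2 * a)))) ` {..<N}) \<le> N"
    by (rule order_trans[OF card_image_le]) simp_all
  ultimately have "card events \<le> 2 * N * card V + N + N"
    unfolding events_def by (intro order_trans[OF card_Un_le] add_mono)
  then show ?thesis by simp
qed

lemma event_of:
  assumes "v \<in> V"
  shows "v \<in> stop ` events"
proof (cases "v = u")
  case True
  then show ?thesis using imageI[OF zero_event, of stop] by (simp only: stop_0)
next
  case False
  then have "v \<in> w ` {..<N}" using assms by (simp only: w_image) simp
  then obtain a where a: "a < N" "v = w a" by auto
  show ?thesis using imageI[OF eventI(2)[OF a(1)], of stop] by (simp only: stop_away a(2))
qed

section \<open>Time until the next event at a vertex\<close>

text \<open>At most \<open>(m + 1) div 2\<close> trips start before \<open>p m\<close>. The others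
  counted start more than \<open>C\<close> apart, so their charge is at most the distance from
  \<open>p m\<close> to \<open>f\<close> plus one further \<open>C\<close>.\<close>

lemma detours_le:
  assumes "p m \<le> f"
  shows "C * real (detours f) \<le> C * real ((m + 1) div 2) + C + (dist_to f - dist_to (p m))"
proof (cases "detours f \<le> (m + 1) div 2")
  case True
  then have "C * real (detours f) \<le> C * real ((m + 1) div 2)"
    using C_pos by (intro mult_left_mono) (simp_all only: of_nat_le_iff less_imp_le)
  then show ?thesis using C_pos dist_to_le_iff[THEN iffD2, OF assms] by linarith
next
  case False
  then obtain a where a: "detours f = Suc a" "(m + 1) div 2 \<le> a" by (cases "detours f") auto
  have "dist_to (p (2 * a)) \<le> dist_to f"
    using less_detours_iff[of a f] a by (simp add: dist_to_le_iff)
  moreover have "dist_to (p m) \<le> dist_to (p (2 * ((m + 1) div 2)))"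
    by (simp add: dist_to_le_iff p_le_iff)
  ultimately show ?thesis using spread[OF a(2)] a(1) by (simp add: algebra_simps)
qed

lemma period_eq: "period = dist_to (p (2 * N)) + C * real N"
  by (simp add: clock_simps detours_p)

lemma period_le: "period \<le> 3 * (C * real N)"
  using dist_to_p_le[of "2 * N"] by (simp add: period_eq)

text \<open>Here \<open>s\<close> is the time of an event at a position \<open>q \<le> p m\<close>.\<close>

lemma next_event:
  assumes v: "v \<in> V" and heavy: "T v < C * real N" and "m \<le> 2 * N"
    and j: "p m \<le> j" "M j = v" "dist_to j \<le> dist_to q + T v + C" "dist_to j \<le> dist_to (p m) + T v"
    and s: "dist_to q + C * real ((m + 1) div 2) \<le> s"
  shows "\<exists>f. kept f \<and> M f = v \<and>
     (p m \<le> f \<and> clock (3 * f) \<le> s + 6 * T v \<or> clock (3 * f) + period \<le> s + 6 * T v)"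
proof -
  have first: "\<exists>f\<ge>i. M f = v \<and> f \<le> j' \<and> (\<forall>k. i \<le> k \<and> k < f \<longrightarrow> M k \<noteq> v)"
    if "i \<le> j'" "M j' = v" for i j'
  proof -
    define f where "f = (LEAST k. i \<le> k \<and> M k = v)"
    have "i \<le> f \<and> M f = v" unfolding f_def by (rule LeastI[of _ j']) (use that in auto)
    moreover have "f \<le> j'" unfolding f_def by (rule Least_le) (use that in auto)
    moreover have "M k \<noteq> v" if "i \<le> k" "k < f" for k
      using not_less_Least[of k "\<lambda>k. i \<le> k \<and> M k = v"] that by (simp add: f_def)
    ultimately show ?thesis by blast
  qed
  have C: "0 < C" "C \<le> T v" using C_pos T_ge[OF v] by auto
  \<comment> \<open>The first visit to \<open>v\<close> from the mark \<open>p m\<close> on is kept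
    if it lies in the window.\<close>
  obtain f where f: "p m \<le> f" "M f = v" "f \<le> j" "\<And>k. \<lbrakk>p m \<le> k; k < f\<rbrakk> \<Longrightarrow> M k \<noteq> v"
    using first[OF j(1,2)] by blast
  have fj: "dist_to f \<le> dist_to j" using f by (simp add: dist_to_le_iff)
  show ?thesis
  proof (cases "f < p (2 * N)")
    case True
    have "kept f" using kept_first_since[OF f(1) True] f by blast
    moreover have "clock (3 * f) \<le> s + 6 * T v"
      using detours_le[OF f(1)] fj j s C unfolding clock_simps by linarith
    ultimately show ?thesis using f by blast
  next
    case False
    then have pj: "dist_to (p (2 * N)) \<le> dist_to j" using f by (simp add: dist_to_le_iff)
    \<comment> \<open>The trips from \<open>p m\<close> to the end of the window are charged at most
      the distance covered there, hence at most \<open>T v\<close>.\<close>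
    have "C * real N - C * real ((m + 1) div 2) \<le> dist_to (p (2 * N)) - dist_to (p (2 * ((m + 1) div 2)))"
      using \<open>m \<le> 2 * N\<close> by (intro spread) linarith
    moreover have "dist_to (p m) \<le> dist_to (p (2 * ((m + 1) div 2)))"
      by (simp add: dist_to_le_iff p_le_iff)
    ultimately have P: "period \<le> s + 2 * T v + C"
      using pj j s unfolding period_eq by linarith
    obtain j0 where j0: "j0 > 0" "M j0 = v" "dist_to j0 \<le> T v"
      using visit'[OF v, of 0] unfolding dist_to_0 diff_0_right by blast
    obtain f0 where f0: "M f0 = v" "f0 \<le> j0" "\<And>k. k < f0 \<Longrightarrow> M k \<noteq> v"
      using first[of 0 j0] j0 by auto
    have f0T: "dist_to f0 \<le> T v" using f0 j0 dist_to_le_iff[of f0 j0] by linarith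
    \<comment> \<open>By \<open>heavy\<close>, the first visit to \<open>v\<close> in
      \<open>M\<close> lies inside the window and can serve in the next repetition.\<close>
    also have "T v < dist_to (p (2 * N))"
      using heavy spread[of 0 N] by (simp add: p_0 dist_to_0)
    finally have "kept f0"
      using kept_first_since[of 0 f0] f0 by (auto simp: p_0 dist_to_less_iff)
    \<comment> \<open>Together with \<open>P\<close> this gives \<open>4 * T v + 2 * C\<close>, at
      most \<open>6 * T v\<close>: the source of the factor 6.\<close>
    moreover have "clock (3 * f0) \<le> 2 * T v + C"
      using detours_le[of 0 f0] f0T unfolding clock_simps by (simp add: p_0 dist_to_0)
    ultimately show ?thesis using P C f0 by (intro exI[of _ f0]) auto
  qed
qed

text \<open>Later visits within the step of \<open>q\<close> need not be kept, so the next event is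
  sought from the following mark on, which costs an extra \<open>C\<close>.\<close>

lemma gap_at_visit:
  assumes v: "v \<in> V" and heavy: "T v < C * real N" and q: "q < p (2 * N)"
    and s: "dist_to q + C * real (detours (Suc q)) \<le> s"
  shows "\<exists>f. kept f \<and> M f = v \<and>
     (q < f \<and> clock (3 * f) \<le> s + 6 * T v \<or> clock (3 * f) + period \<le> s + 6 * T v)"
proof -
  obtain k where k: "p k \<le> q" "q < p (Suc k)" using enclosing by blast
  have kN: "Suc k \<le> 2 * N" using k q p_less_iff[of k "2 * N"] by linarith
  \<comment> \<open>The last visit to \<open>v\<close> after \<open>q\<close> in this step, or
    \<open>q\<close> itself; the next visit then lies at or beyond the mark
    \<open>p (Suc k)\<close>.\<close>
  define q' where "q' = (GREATEST i. i < p (Suc k) \<and> (i = q \<or> (q < i \<and> M i = v)))"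
  have q': "q' < p (Suc k) \<and> (q' = q \<or> (q < q' \<and> M q' = v))"
    unfolding q'_def by (rule GreatestI_nat[of _ q "p (Suc k)"]) (use k in auto)
  obtain j where j: "j > q'" "M j = v" "dist_to j - dist_to q' \<le> T v" using visit'[OF v] by blast
  have "p (Suc k) \<le> j"
  proof (rule ccontr)
    assume "\<not> p (Suc k) \<le> j"
    then have "j \<le> q'" unfolding q'_def using j q' by (intro Greatest_le_nat[of _ _ "p (Suc k)"]) auto
    then show False using j by simp
  qed
  moreover have "dist_to q' \<le> dist_to q + C"
    using step_le[of k] dist_to_le_iff[of "p k" q] dist_to_le_iff[of q' "p (Suc k)"] k q' by linarith
  moreover have "dist_to q' \<le> dist_to (p (Suc k))" using q' by (simp add: dist_to_le_iff)
  moreover have "dist_to q + C * real ((Suc k + 1) div 2) \<le> s"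
  proof -
    \<comment> \<open>\<open>(Suc k + 1) div 2\<close> equals \<open>k div 2 + 1\<close>, and the
      trips \<open>0\<close> to \<open>k div 2\<close> all start at or before
      \<open>q\<close>.\<close>
    have "p (2 * (k div 2)) \<le> q" using order_trans[OF p_le_iff[THEN iffD2] k(1), of "2 * (k div 2)"] by simp
    then have "k div 2 < detours (Suc q)" by (simp add: less_detours_iff)
    then have "C * real ((Suc k + 1) div 2) \<le> C * real (detours (Suc q))" using C_pos by simp
    then show ?thesis using s by linarith
  qed
  ultimately show ?thesis
    using next_event[OF v heavy kN, of j q s] j k by force
qed

lemma gap:
  assumes n: "n \<in> events"
  shows "\<exists>m\<in>events. stop m = stop n \<and>
    (n < m \<and> clock m \<le> clock n + 6 * T (stop n) \<or> clock m + period \<le> clock n + 6 * T (stop n))"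
proof (cases "T (stop n) < C * real N")
  case False
  \<comment> \<open>Here the same event one period later comes soon enough.\<close>
  have "0 \<le> C * real N" using C_pos by simp
  then have "period \<le> 6 * T (stop n)" using period_le False by linarith
  then show ?thesis using n by (intro bexI[of _ n]) auto
next
  case heavy: True
  have v: "stop n \<in> V" by (rule stop_in_V)
  show ?thesis
    using n
  proof (cases rule: eventE)
    case (kept i)
    show ?thesis
    proof (cases "i \<in> range (\<lambda>a. p (2 * a))")
      case True
      \<comment> \<open>A trip starts at this mark; its end is again at \<open>u\<close>,
        \<open>C\<close> later on the clock.\<close>
      then obtain a where a: "i = p (2 * a)" by blast
      have "p (2 * a) < p (2 * N)" using kept a unfolding kept_def by simp
      then have "a < N" by (simp add: p_less_iff)
      moreover have "C \<le> T u" "stop n = u" using kept a T_u by (simp_all add: stop_simps M_p)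
      ultimately show ?thesis
        using kept a C_pos eventI(3)[of a]
        by (intro bexI[of _ "Suc (Suc (3 * p (2 * a)))"])
          (auto simp: stop_simps M_p clock_simps detours_p detours_Suc_p distrib_left)
    next
      case False
      then have "dist_to i + C * real (detours (Suc i)) \<le> clock n"
        using kept by (simp add: clock_simps detours_Suc)
      moreover have "i < p (2 * N)" using kept by (simp add: kept_def)
      ultimately obtain f where "kept f" "M f = stop n"
        "i < f \<and> clock (3 * f) \<le> clock n + 6 * T (stop n) \<or>
         clock (3 * f) + period \<le> clock n + 6 * T (stop n)"
        using gap_at_visit[OF v heavy] by blast
      then show ?thesis
        using eventI(1)[of f] kept by (intro bexI[of _ "3 * f"]) (auto simp: stop_simps)
    qed
  next
    case (home a)
    then have "dist_to (p (2 * a)) + C * real (detours (Suc (p (2 * a)))) \<le> clock n"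
      by (simp add: clock_simps)
    moreover have "p (2 * a) < p (2 * N)" using home by (simp add: p_less_iff)
    ultimately obtain f where f: "kept f" "M f = stop n"
      "p (2 * a) < f \<and> clock (3 * f) \<le> clock n + 6 * T (stop n) \<or>
       clock (3 * f) + period \<le> clock n + 6 * T (stop n)"
      using gap_at_visit[OF v heavy] by blast
    then show ?thesis
      using eventI(1)[of f] home by (intro bexI[of _ "3 * f"]) (auto simp: stop_simps)
  next
    case (away a)
    \<comment> \<open>A turning point is no visit of \<open>M\<close>, so \<open>next_event\<close>
      is applied directly, with the mark \<open>p (2 * a)\<close> as \<open>q\<close>.\<close>
    then have nu: "stop n \<noteq> u" using w_in[of a] by (simp add: stop_away)
    obtain j where j: "j > p (2 * a)" "M j = stop n" "dist_to j - dist_to (p (2 * a)) \<le> T (stop n)"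
      using visit'[OF v] by blast
    have "dist_to (p (2 * a)) + C * real ((2 * a + 1) div 2) \<le> clock n"
      using away loop_dist_nonneg[OF graph in_V stop_in_V] by (simp add: clock_simps detours_p)
    then obtain f where f: "kept f" "M f = stop n"
      "p (2 * a) \<le> f \<and> clock (3 * f) \<le> clock n + 6 * T (stop n) \<or>
       clock (3 * f) + period \<le> clock n + 6 * T (stop n)"
      using next_event[OF v heavy, of "2 * a" j "p (2 * a)" "clock n"] away j C_pos by auto
    moreover have "f \<noteq> p (2 * a)" using nu f M_p by metis
    ultimately show ?thesis
      using eventI(1)[of f] away by (intro bexI[of _ "3 * f"]) (auto simp: stop_simps)
  qed
qed

lemma periodic_walk:
  "\<exists>W. walk V W \<and> length W \<le> 2 * N * card V + 2 * N \<and> infinite_walk V (Delta W) \<and>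
       (\<forall>v\<in>V. latency d (Delta W) v \<le> ereal (6 * T v))"
proof -
  \<comment> \<open>The way across the end of the period is split at the end of the window, which is
    at the same vertex as stop 0.\<close>
  have wrap: "loop_dist d (stop n) (stop m) \<le> clock m + period - clock n"
    if "n \<in> events" "m \<in> events" for n m
  proof -
    have "loop_dist d (stop n) (stop m) \<le> loop_dist d (stop n) (stop (3 * p (2 * N)))
        + loop_dist d (stop (3 * p (2 * N))) (stop m)"
      by (rule loop_dist_triangle[OF graph stop_in_V stop_in_V stop_in_V])
    also have "loop_dist d (stop n) (stop (3 * p (2 * N))) \<le> period - clock n"
      using event_less[OF that(1)] by (intro stop_clock) simp
    also have "stop (3 * p (2 * N)) = stop 0" by (simp only: stop_simps(1) M_p stop_0)
    also have "loop_dist d (stop 0) (stop m) \<le> clock m - clock 0" by (rule stop_clock) simp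
    also have "clock 0 = 0"
      using clock_simps(1)[of 0] detours_p[of 0] by (simp add: dist_to_0 p_0)
    finally show ?thesis by simp
  qed
  have "\<exists>W. walk V W \<and> length W = card events \<and> infinite_walk V (Delta W) \<and>
      (\<forall>v\<in>stop ` events. latency d (Delta W) v \<le> ereal (6 * T v))"
    using zero_event
    by (intro schedule_walk[where \<sigma> = clock and P = period] graph finite_events stop_in_V stop_clock wrap separated
        separated_wrap gap) auto
  then show ?thesis using card_events event_of by (metis)
qed

end


section \<open>Approximating the optimal cost\<close>

lemma (in frequent_walk) periodic_walk_exists:
  assumes "2 \<le> card V"
  shows "\<exists>W. walk V W \<and> length W \<le> 2 * card V ^ 2 \<and> infinite_walk V (Delta W) \<and>
             (\<forall>v\<in>V. latency d (Delta W) v \<le> ereal (6 * T v))"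
proof -
  obtain nxt where nxt: "\<And>i. M i = u \<Longrightarrow> i < nxt i \<and> M (nxt i) = u \<and>
      dist_to (nxt i) - dist_to i \<le> C \<and> (\<forall>j>nxt i. M j = u \<longrightarrow> C < dist_to j - dist_to i)"
    using farthest_return by metis
  define p where "p k = (nxt ^^ k) 0" for k
  have p: "p 0 = 0" "p (Suc k) = nxt (p k)" for k by (simp_all add: p_def)
  have Mp: "M (p k) = u" for k by (induction k) (simp_all add: p M_0 nxt)
  define N where "N = card (V - {u})"
  have finV: "finite V" by (rule metric_graphD(1)[OF graph])
  have N: "N = card V - 1" using finV u_in_V by (simp add: N_def)
  obtain h where h: "bij_betw h {0..<N} (V - {u})"
    using ex_bij_betw_nat_finite[of "V - {u}"] finV by (auto simp: N_def)
  then have h_image: "h ` {..<N} = V - {u}" by (simp add: bij_betw_def atLeast0LessThan)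
  have "0 < N" using N assms by simp
  \<comment> \<open>Reducing modulo \<open>N\<close> keeps the values of \<open>h\<close> in
    \<open>V - {u}\<close> at all arguments.\<close>
  interpret marked_walk V d M u C T p "\<lambda>a. h (a mod N)" N
  proof
    fix k a
    show "p k < p (Suc k)" "dist_to (p (Suc k)) - dist_to (p k) \<le> C"
      "C < dist_to (p (Suc (Suc k))) - dist_to (p k)"
      using nxt[OF Mp[of k]] nxt[OF Mp[of "Suc k"]] by (simp_all add: p)
    have "(\<lambda>a. h (a mod N)) ` {..<N} = h ` {..<N}" by (rule image_cong) auto
    then show "(\<lambda>a. h (a mod N)) ` {..<N} = V - {u}" using h_image by simp
    have "h (a mod N) \<in> h ` {..<N}" using \<open>0 < N\<close> by (intro imageI) simp
    then show "h (a mod N) \<in> V - {u}" using h_image by simp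
  qed (fact p Mp \<open>0 < N\<close>)+
  have "2 * N * card V + 2 * N = 2 * card V ^ 2 - 2"
    using N assms by (cases "card V") (simp_all add: power2_eq_square)
  then show ?thesis using periodic_walk by (metis diff_le_self order_trans)
qed

text \<open>Once every vertex of \<open>A\<close> has occurred, each position lies between two
  consecutive occurrences of \<open>v\<close>, and the rest of that sub-walk is no longer than the
  whole.\<close>

lemma frequent_visits:
  assumes G: "metric_graph V d" and walk: "infinite_walk V M"
    and fin: "finite A" and recur: "\<And>v. v \<in> A \<Longrightarrow> infinite {i. M i = v}"
    and bound: "\<And>v i j. \<lbrakk>v \<in> A; (i, j) \<in> consecutive_occurrences M v\<rbrakk> \<Longrightarrow> subwalk_length d M i j \<le> T v"
  shows "\<exists>s. \<forall>k\<ge>s. \<forall>v\<in>A. \<exists>j>k. M j = v \<and> subwalk_length d M k j \<le> T v"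
proof -
  have "\<exists>i. M i = v" if "v \<in> A" for v
    using recur[OF that] by (metis (mono_tags) Collect_empty_eq finite.emptyI)
  then obtain i0 where i0: "\<And>v. v \<in> A \<Longrightarrow> M (i0 v) = v" by metis
  have "\<exists>j>k. M j = v \<and> subwalk_length d M k j \<le> T v"
    if k: "k \<ge> Max (i0 ` A)" and v: "v \<in> A" for k v
  proof -
    have "i0 v \<le> k" using k v fin by (meson Max_ge finite_imageI imageI order_trans)
    define i where "i = (GREATEST i. i \<le> k \<and> M i = v)"
    have i: "i \<le> k \<and> M i = v"
      unfolding i_def by (rule GreatestI_nat[of _ "i0 v" k]) (use \<open>i0 v \<le> k\<close> i0 v in auto)
    have i_max: "l \<le> i" if "l \<le> k" "M l = v" for l
      unfolding i_def by (rule Greatest_le_nat[of _ _ k]) (use that in auto)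
    obtain j' where j': "k < j'" "M j' = v"
      using recur[OF v] unfolding infinite_nat_iff_unbounded by blast
    define j where "j = (LEAST j. k < j \<and> M j = v)"
    have j: "k < j \<and> M j = v"
      unfolding j_def by (rule LeastI[of _ j']) (use j' in auto)
    have "M l \<noteq> v" if "i < l" "l < j" for l
      using i_max[of l] that not_less_Least[of l "\<lambda>j. k < j \<and> M j = v"] by (force simp: j_def)
    then have "(i, j) \<in> consecutive_occurrences M v"
      using i j by (auto simp: consecutive_occurrences_def)
    then have "subwalk_length d M i j \<le> T v" by (rule bound[OF v])
    then have "subwalk_length d M k j \<le> T v"
      using subwalk_length_split[of i k j d M] subwalk_length_nonneg[OF G walk, of i k] i j by simp
    then show ?thesis using j by blast
  qed
  then show ?thesis by blast
qed

lemma subwalk_length_shift: "subwalk_length d (\<lambda>i. M (i + s)) i j = subwalk_length d M (i + s) (j + s)"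
  by (simp add: subwalk_length_def sum.shift_bounds_nat_ivl)

lemma latency_le_of_cost_le:
  assumes "finite V" "v \<in> V" "0 < \<phi> v" "cost V d \<phi> M \<le> ereal C"
  shows "latency d M v \<le> ereal (C / \<phi> v)"
proof -
  have "ereal (\<phi> v) * latency d M v \<le> cost V d \<phi> M"
    unfolding cost_def using assms by (intro Max_ge) auto
  then have "ereal (\<phi> v) * latency d M v \<le> ereal C" using assms(4) by (rule order_trans)
  then show ?thesis
    using assms(3) by (cases "latency d M v") (auto simp: field_simps)
qed

lemma periodic_approximation:
  assumes G: "metric_graph V d" and n: "2 \<le> card V"
    and \<phi>: "\<And>v. v \<in> V \<Longrightarrow> 0 < \<phi> v \<and> \<phi> v \<le> 1" and u: "u \<in> V" "\<phi> u = 1"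
    and walk: "infinite_walk V M" and cost: "cost V d \<phi> M \<le> ereal C"
  shows "\<exists>W. walk V W \<and> length W \<le> 2 * card V ^ 2 \<and> infinite_walk V (Delta W) \<and>
             cost V d \<phi> (Delta W) \<le> ereal (6 * C)"
proof -
  define T where "T v = C / \<phi> v" for v
  have finV: "finite V" by (rule metric_graphD(1)[OF G])
  have lat: "latency d M v \<le> ereal (T v)" if "v \<in> V" for v
    unfolding T_def using latency_le_of_cost_le[OF finV that _ cost] \<phi>[OF that] by blast
  have recur: "infinite {i. M i = v}" if "v \<in> V" for v
    using lat[OF that] by (auto simp: latency_def split: if_splits)
  have bound: "subwalk_length d M i j \<le> T v" if "v \<in> V" "(i, j) \<in> consecutive_occurrences M v" for v i j
  proof -
    have "ereal (subwalk_length d M i j) \<le> latency d M v"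
      using recur[OF that(1)] that(2) by (auto simp: latency_def intro!: SUP_upper2[of "(i, j)"])
    then show ?thesis using lat[OF that(1)] by (metis ereal_less_eq(3) order_trans)
  qed
  obtain s0 where s0: "\<And>k v. \<lbrakk>k \<ge> s0; v \<in> V\<rbrakk> \<Longrightarrow> \<exists>j>k. M j = v \<and> subwalk_length d M k j \<le> T v"
    using frequent_visits[where T = T, OF G walk finV recur bound] by blast
  \<comment> \<open>The tail from \<open>s\<close> on starts at \<open>u\<close> and lies in the
    range where \<open>s0\<close> guarantees frequent visits.\<close>
  obtain s where s: "s \<ge> s0" "M s = u" using s0[of s0 u] u by (meson less_imp_le order_refl)
  have "0 \<le> T u"
    using s0[of s u] s u subwalk_length_nonneg[OF G walk] by (meson order_trans)
  then have "0 \<le> C" using u by (simp add: T_def)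
  interpret frequent_walk V d "\<lambda>i. M (i + s)" u C T
  proof
    show "infinite_walk V (\<lambda>i. M (i + s))" using walk by (simp add: infinite_walk_def)
    fix v i assume v: "v \<in> V"
    obtain j where j: "j > i + s" "M j = v" "subwalk_length d M (i + s) j \<le> T v"
      using s0[of "i + s" v] trans_le_add2[OF s(1)] v by blast
    moreover from j have "i < j - s" "j - s + s = j" by simp_all
    ultimately show "\<exists>j>i. M (j + s) = v \<and> subwalk_length d (\<lambda>i. M (i + s)) i j \<le> T v"
      by (intro exI[of _ "j - s"]) (simp only: subwalk_length_shift simp_thms)
  next
    fix v assume "v \<in> V"
    then show "C \<le> T v" using \<phi>[of v] \<open>0 \<le> C\<close> mult_left_mono[of "\<phi> v" 1 C]
      by (simp add: T_def field_simps)
  qed (use G s u in \<open>simp_all add: T_def\<close>)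
  obtain W where W: "walk V W" "length W \<le> 2 * card V ^ 2" "infinite_walk V (Delta W)"
    "\<And>v. v \<in> V \<Longrightarrow> latency d (Delta W) v \<le> ereal (6 * T v)"
    using periodic_walk_exists[OF n] by blast
  have "ereal (\<phi> v) * latency d (Delta W) v \<le> ereal (6 * C)" if "v \<in> V" for v
  proof -
    have "ereal (\<phi> v) * latency d (Delta W) v \<le> ereal (\<phi> v) * ereal (6 * T v)"
      using W(4)[OF that] \<phi>[OF that] by (intro ereal_mult_left_mono) auto
    also have "\<dots> = ereal (6 * C)" using \<phi>[OF that] by (simp add: T_def)
    finally show ?thesis .
  qed
  then have "cost V d \<phi> (Delta W) \<le> ereal (6 * C)"
    unfolding cost_def using finV u by (intro Max.boundedI) auto
  then show ?thesis using W by blast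
qed

text \<open>Visiting all vertices cyclically in any order shows that the set of short walks, over
  which the theorem minimises, is nonempty.\<close>

lemma short_walk_exists:
  assumes "2 \<le> card V"
  shows "\<exists>W. walk V W \<and> length W = card V \<and> infinite_walk V (Delta W)"
proof -
  have "finite V" using assms by (metis card.infinite not_numeral_le_zero)
  then obtain W where W: "set W = V" "distinct W" using finite_distinct_list by blast
  have len: "length W = card V" using W distinct_card by fastforce
  have "adjacent V (Delta W i) (Delta W (Suc i))" for i
  proof -
    have "i mod length W < length W" "Suc i mod length W < length W"
      using assms len by (auto intro!: mod_less_divisor)
    moreover have "i mod length W \<noteq> Suc i mod length W"
      using assms len by (auto simp: mod_Suc)
    ultimately show ?thesis
      using W by (auto simp: adjacent_def Delta_def nth_eq_iff_index_eq)
  qed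
  moreover have "walk V W"
    using W assms len by (auto simp: walk_def adjacent_def successively_conv_nth nth_eq_iff_index_eq)
  ultimately show ?thesis using len by (auto simp: infinite_walk_def)
qed

theorem theorem4p6:
  "\<exists>f :: nat \<Rightarrow> real. f \<in> O(\<lambda>n. real n ^ 2) \<and>
     (\<forall>(V :: 'a set) (d :: 'a \<Rightarrow> 'a \<Rightarrow> real) (\<phi> :: 'a \<Rightarrow> real).
        metric_graph V d \<and> 2 \<le> card V \<and>
        (\<forall>v\<in>V. 0 < \<phi> v \<and> \<phi> v \<le> 1) \<and> (\<exists>v\<in>V. \<phi> v = 1) \<longrightarrow>
        (\<exists>W. walk V W \<and> real (length W) \<le> f (card V) \<and>
             infinite_walk V (Delta W) \<and>
             cost V d \<phi> (Delta W) \<le> 6 * OPT V d \<phi>))"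
proof (intro exI[of _ "\<lambda>n. 2 * real n ^ 2"] conjI allI impI; (elim conjE)?)
  show "(\<lambda>n. 2 * real n ^ 2) \<in> O(\<lambda>n. real n ^ 2)" by simp
next
  fix V :: "'a set" and d :: "'a \<Rightarrow> 'a \<Rightarrow> real" and \<phi> :: "'a \<Rightarrow> real"
  assume G: "metric_graph V d" and n: "2 \<le> card V"
    and \<phi>: "\<forall>v\<in>V. 0 < \<phi> v \<and> \<phi> v \<le> 1" and "\<exists>v\<in>V. \<phi> v = 1"
  then obtain u where u: "u \<in> V" "\<phi> u = 1" by blast
  define \<W> where "\<W> = {W. walk V W \<and> length W \<le> 2 * card V ^ 2 \<and> infinite_walk V (Delta W)}"
  have finV: "finite V" by (rule metric_graphD(1)[OF G])
  have "finite \<W>"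
    by (rule finite_subset[OF _ finite_lists_length_le[OF finV, of "2 * card V ^ 2"]])
      (auto simp: \<W>_def walk_def)
  obtain W0 where W0: "walk V W0" "length W0 = card V" "infinite_walk V (Delta W0)"
    using short_walk_exists[OF n] by blast
  have "card V \<le> 2 * card V ^ 2" using n by (simp add: power2_eq_square)
  then have "W0 \<in> \<W>" using W0 by (simp add: \<W>_def)
  then have "\<W> \<noteq> {}" by blast
  then obtain W where W: "W \<in> \<W>" "\<And>W'. W' \<in> \<W> \<Longrightarrow> cost V d \<phi> (Delta W) \<le> cost V d \<phi> (Delta W')"
    using ex_is_arg_min_if_finite[OF \<open>finite \<W>\<close>, of "\<lambda>W. cost V d \<phi> (Delta W)"]
    by (auto simp: is_arg_min_linorder)
  have "cost V d \<phi> (Delta W) / 6 \<le> cost V d \<phi> M" if M: "infinite_walk V M" for M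
  proof -
    have le: "cost V d \<phi> (Delta W) \<le> ereal (6 * C)" if C: "cost V d \<phi> M \<le> ereal C" for C
    proof -
      obtain W' where "W' \<in> \<W>" "cost V d \<phi> (Delta W') \<le> ereal (6 * C)"
        using periodic_approximation[OF G n bspec[OF \<phi>] u M C] unfolding \<W>_def by blast
      then show ?thesis using W(2) order_trans by blast
    qed
    show ?thesis
    \<comment> \<open>Only real upper bounds of the cost of \<open>M\<close> matter; an infinite
      cost has none.\<close>
    proof (rule ereal_le_real)
      fix C assume "cost V d \<phi> M \<le> ereal C"
      from le[OF this] show "cost V d \<phi> (Delta W) / 6 \<le> ereal C"
        by (cases "cost V d \<phi> (Delta W)") auto
    qed
  qed
  then have "cost V d \<phi> (Delta W) / 6 \<le> OPT V d \<phi>"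
    unfolding OPT_def by (intro INF_greatest) auto
  then have "cost V d \<phi> (Delta W) \<le> 6 * OPT V d \<phi>"
    by (cases "cost V d \<phi> (Delta W)"; cases "OPT V d \<phi>") auto
  moreover have "real (length W) \<le> 2 * real (card V) ^ 2"
    using W(1) unfolding \<W>_def by (auto simp flip: of_nat_le_iff[where 'a = real])
  ultimately show "\<exists>W. walk V W \<and> real (length W) \<le> 2 * real (card V) ^ 2 \<and>
      infinite_walk V (Delta W) \<and> cost V d \<phi> (Delta W) \<le> 6 * OPT V d \<phi>"
    using W(1) unfolding \<W>_def by blast
qed

end
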